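(* Let $(X,d)$ be a complete semimetric space with triangle function $\Phi$, where $\Phi$ is one of $\Phi(u,v)=u+v$, $\Phi(u,v)=\max\{u,v\}$, or $\Phi(u,v)=(u^q+v^q)^{1/q}$ with $q>0$. Let $T\colon X\to X$ be a mapping for which there exist real numbers $\alpha,\delta$ with $0\le\alpha<1$ and $\delta\ge 0$ such that $$d(Tx,Ty)\le \alpha\, d(x,y)+\delta\, d(y,Tx)\quad\text{for all } x,y\in X.$$ Then $T$ has a fixed point, and if $\delta=0$ the fixed point is unique. Moreover, for every $x_0\in X$, with $x_n=T^nx_0$, there is a fixed point $x^*$ of $T$ such that for all $n\ge 0$: $$d(x_n,x^* )\le\frac{\alpha^n}{1-\alpha}\,d(x_0,x_1)\quad\text{if }\Phi(u,v)=u+v,$$ $$d(x_n,x^* )\le\alpha^n\,d(x_0,x_1)\quad\text{if }\Phi(u,v)=\max\{u,v\},$$ $$d(x_n,x^* )\le\frac{\alpha^n}{(1-\alpha^q)^{1/q}}\,d(x_0,x_1)\quad\text{if }\Phi(u,v)=(u^q+v^q)^{1/q},\ q>0.$$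
   Context: $\mathbb{R}^+=[0,\infty)$. A semimetric space $(X,d)$ is a nonempty set $X$ with a function $d\colon X\times X\to\mathbb{R}^+$ such that for all $x,y\in X$: $d(x,y)=0$ if and only if $x=y$, and $d(x,y)=d(y,x)$. A function $\Phi\colon\mathbb{R}^+\times\mathbb{R}^+\to\mathbb{R}^+$ is a triangle function for $d$ if $\Phi$ is symmetric and non-decreasing in both of its arguments, $\Phi(0,0)=0$, and $d(x,y)\le\Phi(d(x,z),d(z,y))$ for all $x,y,z\in X$. A sequence $(x_n)$ in $X$ converges to $x\in X$ if $d(x_n,x)\to 0$; it is Cauchy if $d(x_n,x_m)\to 0$ as $n,m\to\infty$; $(X,d)$ is complete if every Cauchy sequence converges to some point of $X$. Convention: $0^0=1$. *)

theory Defs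
  imports Complex_Main "HOL-Library.FuncSet"
begin

definition semimetric_space :: "'a set \<Rightarrow> ('a \<Rightarrow> 'a \<Rightarrow> real) \<Rightarrow> bool" where
  "semimetric_space X d \<longleftrightarrow>
     X \<noteq> {} \<and>
     (\<forall>x\<in>X. \<forall>y\<in>X. 0 \<le> d x y \<and> (d x y = 0 \<longleftrightarrow> x = y) \<and> d x y = d y x)"

(* A triangle function maps [0,oo) x [0,oo) to [0,oo); it is encoded as a total function on the
   reals, of which only the values at nonnegative arguments are ever constrained or used. *)
definition triangle_function ::
    "'a set \<Rightarrow> ('a \<Rightarrow> 'a \<Rightarrow> real) \<Rightarrow> (real \<Rightarrow> real \<Rightarrow> real) \<Rightarrow> bool" where
  "triangle_function X d \<Phi> \<longleftrightarrow>
     (\<forall>u\<ge>0. \<forall>v\<ge>0. 0 \<le> \<Phi> u v) \<and>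
     (\<forall>u\<ge>0. \<forall>v\<ge>0. \<Phi> u v = \<Phi> v u) \<and>
     (\<forall>u\<ge>0. \<forall>u'\<ge>u. \<forall>v\<ge>0. \<Phi> u v \<le> \<Phi> u' v) \<and>
     (\<forall>u\<ge>0. \<forall>v\<ge>0. \<forall>v'\<ge>v. \<Phi> u v \<le> \<Phi> u v') \<and>
     \<Phi> 0 0 = 0 \<and>
     (\<forall>x\<in>X. \<forall>y\<in>X. \<forall>z\<in>X. d x y \<le> \<Phi> (d x z) (d z y))"

definition eq_on_nonneg :: "(real \<Rightarrow> real \<Rightarrow> real) \<Rightarrow> (real \<Rightarrow> real \<Rightarrow> real) \<Rightarrow> bool" where
  "eq_on_nonneg \<Phi> \<Psi> \<longleftrightarrow> (\<forall>u\<ge>0. \<forall>v\<ge>0. \<Phi> u v = \<Psi> u v)"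

definition semimetric_converges ::
    "('a \<Rightarrow> 'a \<Rightarrow> real) \<Rightarrow> (nat \<Rightarrow> 'a) \<Rightarrow> 'a \<Rightarrow> bool" where
  "semimetric_converges d s x \<longleftrightarrow> (\<lambda>n. d (s n) x) \<longlonglongrightarrow> 0"

definition semimetric_Cauchy :: "('a \<Rightarrow> 'a \<Rightarrow> real) \<Rightarrow> (nat \<Rightarrow> 'a) \<Rightarrow> bool" where
  "semimetric_Cauchy d s \<longleftrightarrow>
     ((\<lambda>(n, m). d (s n) (s m)) \<longlongrightarrow> 0) (sequentially \<times>\<^sub>F sequentially)"

definition semimetric_complete :: "'a set \<Rightarrow> ('a \<Rightarrow> 'a \<Rightarrow> real) \<Rightarrow> bool" where
  "semimetric_complete X d \<longleftrightarrow>
     (\<forall>s. range s \<subseteq> X \<and> semimetric_Cauchy d s \<longrightarrow> (\<exists>x\<in>X. semimetric_converges d s x))"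

end

theory Submission
  imports Defs
begin

text \<open>
  All three triangle functions share three properties: \<open>\<Phi>\<close> is positively homogeneous, continuous in its
  second argument, and \<open>\<Phi> 1 0 = 1\<close>.  These suffice for a Picard iteration argument.

  Applying the contraction condition to \<open>x = x\<^sub>n\<close>, \<open>y = x\<^sub>n\<^sub>+\<^sub>1 = T x\<^sub>n\<close> kills the \<open>\<delta>\<close>-term, so consecutive
  distances decay like \<open>\<alpha> ^ n\<close>.  Unfolding the triangle inequality from the left, a bound of the form
  \<open>d x\<^sub>n x\<^sub>m \<le> \<alpha> ^ n * k * d x\<^sub>0 x\<^sub>1\<close> propagates as soon as \<open>\<Phi> 1 (\<alpha> * k) \<le> k\<close>, by homogeneity.  Hence the
  constants of the theorem: they are the solutions of the equation \<open>\<Phi> 1 (\<alpha> * k) = k\<close>, namely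
  \<open>1 / (1 - \<alpha>)\<close>, \<open>1\<close>, and \<open>1 / (1 - \<alpha> powr q) powr (1 / q)\<close> (\<open>admissible_ratio_sum\<close>,
  \<open>admissible_ratio_max\<close>, \<open>admissible_ratio_power\<close>).  The bound makes the orbit Cauchy, and it survives
  the passage \<open>m \<rightarrow> \<infinity>\<close> because \<open>\<Phi> u v \<rightarrow> u\<close> as \<open>v \<rightarrow> 0\<close> (\<open>dist_le_of_limit\<close>).  The contraction condition
  also forces \<open>x\<^sub>n\<^sub>+\<^sub>1 \<rightarrow> T x\<close> when \<open>x\<^sub>n \<rightarrow> x\<close>; limits being unique, \<open>x\<close> is fixed.
\<close>

section \<open>Homogeneous triangle functions\<close>

text \<open>Only arguments in \<open>[0,\<infinity>)\<close> matter, so that each condition depends on the values of \<open>\<Phi>\<close> there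
  alone; this lets it be transported along \<^const>\<open>eq_on_nonneg\<close>.\<close>

definition homogeneous_gauge :: "(real \<Rightarrow> real \<Rightarrow> real) \<Rightarrow> bool" where
  "homogeneous_gauge \<Phi> \<longleftrightarrow>
     (\<forall>t\<ge>0. \<forall>u\<ge>0. \<forall>v\<ge>0. \<Phi> (t * u) (t * v) = t * \<Phi> u v) \<and>
     (\<forall>u\<ge>0. continuous_on {0..} (\<Phi> u)) \<and>
     \<Phi> 1 0 = 1"

definition admissible_ratio :: "(real \<Rightarrow> real \<Rightarrow> real) \<Rightarrow> real \<Rightarrow> real \<Rightarrow> bool" where
  "admissible_ratio \<Phi> \<alpha> k \<longleftrightarrow> 0 \<le> k \<and> \<Phi> 1 (\<alpha> * k) \<le> k"

lemma homogeneous_gauge_cong: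
  assumes "eq_on_nonneg \<Phi> \<Psi>" and "homogeneous_gauge \<Psi>"
  shows "homogeneous_gauge \<Phi>"
proof -
  have "continuous_on {0..} (\<Phi> u)" if "u \<ge> 0" for u
    using assms that continuous_on_cong[of "{0..}" "{0..}" "\<Phi> u" "\<Psi> u"]
    by (auto simp: eq_on_nonneg_def homogeneous_gauge_def)
  then show ?thesis
    using assms by (auto simp: eq_on_nonneg_def homogeneous_gauge_def)
qed

lemma admissible_ratio_cong:
  assumes "eq_on_nonneg \<Phi> \<Psi>" and "admissible_ratio \<Psi> \<alpha> k" and "0 \<le> \<alpha>"
  shows "admissible_ratio \<Phi> \<alpha> k"
  using assms by (auto simp: eq_on_nonneg_def admissible_ratio_def)

lemma homogeneous_gauge_sum: "homogeneous_gauge (\<lambda>u v. u + v)"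
  by (auto simp: homogeneous_gauge_def algebra_simps intro!: continuous_intros)

lemma homogeneous_gauge_max: "homogeneous_gauge (\<lambda>u v. max u v)"
  by (auto simp: homogeneous_gauge_def max_mult_distrib_left intro!: continuous_intros)

lemma homogeneous_gauge_power:
  assumes "q > 0"
  shows "homogeneous_gauge (\<lambda>u v. (u powr q + v powr q) powr (1 / q))"
proof -
  have "((t * u) powr q + (t * v) powr q) powr (1 / q) = t * (u powr q + v powr q) powr (1 / q)"
    if "t \<ge> 0" "u \<ge> 0" "v \<ge> 0" for t u v :: real
  proof -
    have "((t * u) powr q + (t * v) powr q) powr (1 / q)
        = (t powr q * (u powr q + v powr q)) powr (1 / q)"
      using that by (simp add: powr_mult distrib_left)
    also have "\<dots> = t * (u powr q + v powr q) powr (1 / q)"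
      using that assms by (simp add: powr_mult powr_powr)
    finally show ?thesis .
  qed
  moreover have "continuous_on {0..} (\<lambda>v. (u powr q + v powr q) powr (1 / q))" for u :: real
    using assms by (auto intro!: continuous_intros continuous_on_powr')
  ultimately show ?thesis
    using assms by (simp add: homogeneous_gauge_def)
qed

lemma admissible_ratio_sum:
  assumes "\<alpha> < 1"
  shows "admissible_ratio (\<lambda>u v. u + v) \<alpha> (1 / (1 - \<alpha>))"
  using assms by (simp add: admissible_ratio_def field_simps)

lemma admissible_ratio_max:
  assumes "\<alpha> < 1"
  shows "admissible_ratio (\<lambda>u v. max u v) \<alpha> 1"
  using assms by (simp add: admissible_ratio_def)

text \<open>With \<open>a = \<alpha> powr q\<close>, the \<open>q\<close>-th power of the constant is the geometric sum \<open>1 / (1 - a)\<close>, which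
  solves \<open>1 + a * s = s\<close>.\<close>

lemma admissible_ratio_power:
  assumes "q > 0" and "0 \<le> \<alpha>" and "\<alpha> < 1"
  shows "admissible_ratio (\<lambda>u v. (u powr q + v powr q) powr (1 / q)) \<alpha>
           (1 / (1 - \<alpha> powr q) powr (1 / q))"
proof -
  define a where "a = \<alpha> powr q"
  define k where "k = 1 / (1 - a) powr (1 / q)"
  have a: "a < 1"
    using assms powr_less_mono2[of q \<alpha> 1] by (simp add: a_def)
  have kq: "k powr q = 1 / (1 - a)"
    using a assms by (simp add: k_def powr_divide powr_powr)
  have "(\<alpha> * k) powr q = a * (1 / (1 - a))"
    using assms(2) by (subst powr_mult) (simp_all add: kq a_def)
  then have "1 powr q + (\<alpha> * k) powr q = 1 + a * (1 / (1 - a))"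
    by simp
  also have "\<dots> = 1 / (1 - a)"
    using a by (simp add: field_simps)
  finally have "(1 powr q + (\<alpha> * k) powr q) powr (1 / q) = k"
    using a by (simp add: k_def powr_divide)
  then show ?thesis
    by (simp add: admissible_ratio_def k_def a_def)
qed

section \<open>Limits in semimetric spaces with a homogeneous triangle function\<close>

locale homogeneous_semimetric =
  fixes X :: "'a set" and d :: "'a \<Rightarrow> 'a \<Rightarrow> real" and \<Phi> :: "real \<Rightarrow> real \<Rightarrow> real"
  assumes semimetric: "semimetric_space X d"
    and triangle: "triangle_function X d \<Phi>"
    and gauge: "homogeneous_gauge \<Phi>"
begin

lemma dist_nonneg: "x \<in> X \<Longrightarrow> y \<in> X \<Longrightarrow> 0 \<le> d x y"
  and dist_eq_0_iff: "x \<in> X \<Longrightarrow> y \<in> X \<Longrightarrow> d x y = 0 \<longleftrightarrow> x = y"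
  and dist_sym: "x \<in> X \<Longrightarrow> y \<in> X \<Longrightarrow> d x y = d y x"
  using semimetric by (simp_all add: semimetric_space_def)

lemma gauge_scale: "t \<ge> 0 \<Longrightarrow> u \<ge> 0 \<Longrightarrow> v \<ge> 0 \<Longrightarrow> \<Phi> (t * u) (t * v) = t * \<Phi> u v"
  using gauge by (simp add: homogeneous_gauge_def)

lemma gauge_right_0: "u \<ge> 0 \<Longrightarrow> \<Phi> u 0 = u"
  using gauge gauge_scale[of u 1 0] by (simp add: homogeneous_gauge_def)

lemma dist_le_gauge:
  assumes "x \<in> X" "y \<in> X" "z \<in> X" and "d x z \<le> u" and "d z y \<le> v"
  shows "d x y \<le> \<Phi> u v"
proof -
  have "d x y \<le> \<Phi> (d x z) (d z y)"
    using triangle assms by (simp add: triangle_function_def)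
  also have "\<dots> \<le> \<Phi> u (d z y)"
    using triangle assms dist_nonneg by (simp add: triangle_function_def)
  also have "\<dots> \<le> \<Phi> u v"
    using triangle assms dist_nonneg[of x z] dist_nonneg[of z y] by (simp add: triangle_function_def)
  finally show ?thesis .
qed

text \<open>A semimetric need not be continuous, but here \<open>d y x \<le> \<Phi> u (d (s n) x)\<close>, and the right-hand side
  tends to \<open>\<Phi> u 0 = u\<close>.\<close>

lemma dist_le_of_limit:
  assumes s: "\<And>n. s n \<in> X" and x: "x \<in> X" and y: "y \<in> X"
    and lim: "semimetric_converges d s x"
    and bound: "\<forall>\<^sub>F n in sequentially. d y (s n) \<le> u"
  shows "d y x \<le> u"
proof -
  obtain n where "d y (s n) \<le> u"
    using bound by (auto simp: eventually_sequentially)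
  then have u: "u \<ge> 0"
    using dist_nonneg[OF y s, of n] by linarith
  have "(\<lambda>n. \<Phi> u (d (s n) x)) \<longlonglongrightarrow> \<Phi> u 0"
  proof (rule continuous_on_tendsto_compose[of "{0..}" "\<Phi> u"])
    show "continuous_on {0..} (\<Phi> u)"
      using gauge u by (simp add: homogeneous_gauge_def)
    show "(\<lambda>n. d (s n) x) \<longlonglongrightarrow> 0"
      using lim by (simp add: semimetric_converges_def)
  qed (use s x dist_nonneg in auto)
  then have "(\<lambda>n. \<Phi> u (d (s n) x)) \<longlonglongrightarrow> u"
    using u by (simp add: gauge_right_0)
  moreover have "\<forall>\<^sub>F n in sequentially. d y x \<le> \<Phi> u (d (s n) x)"
    using bound
  proof eventually_elim
    case (elim n)
    then show ?case using s x y by (intro dist_le_gauge[of y x "s n"]) auto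
  qed
  ultimately show ?thesis
    by (rule tendsto_lowerbound) simp
qed

lemma limit_unique:
  assumes s: "\<And>n. s n \<in> X" and x: "x \<in> X" and y: "y \<in> X"
    and "semimetric_converges d s x" and limy: "semimetric_converges d s y"
  shows "x = y"
proof -
  have "d y x \<le> e" if "e > 0" for e
  proof (rule dist_le_of_limit)
    have "\<forall>\<^sub>F n in sequentially. d (s n) y < e"
      using limy that by (auto simp: semimetric_converges_def intro: order_tendstoD(2))
    then show "\<forall>\<^sub>F n in sequentially. d y (s n) \<le> e"
      using dist_sym[OF y s] by (simp add: eventually_mono)
  qed (use assms in auto)
  then have "d y x \<le> 0"
    by (rule field_le_epsilon[of "d y x" 0, simplified])
  then show ?thesis
    using dist_nonneg[OF y x] dist_eq_0_iff[OF y x] by simp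
qed

end

section \<open>Orbits of the contraction\<close>

locale almost_contraction = homogeneous_semimetric X d \<Phi>
  for X :: "'a set" and d :: "'a \<Rightarrow> 'a \<Rightarrow> real" and \<Phi> :: "real \<Rightarrow> real \<Rightarrow> real" +
  fixes T :: "'a \<Rightarrow> 'a" and \<alpha> \<delta> :: real
  assumes maps: "T \<in> X \<rightarrow> X"
    and alpha_nonneg: "0 \<le> \<alpha>"
    and alpha_less_1: "\<alpha> < 1"
    and contraction: "\<And>x y. x \<in> X \<Longrightarrow> y \<in> X \<Longrightarrow> d (T x) (T y) \<le> \<alpha> * d x y + \<delta> * d y (T x)"
begin

lemma orbit_in: "x0 \<in> X \<Longrightarrow> (T ^^ n) x0 \<in> X"
  by (induction n) (use maps in auto)

text \<open>For \<open>y = T x\<close> the \<open>\<delta>\<close>-term of the contraction condition is \<open>\<delta> * d (T x) (T x) = 0\<close>.\<close>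

lemma orbit_step:
  assumes x0: "x0 \<in> X"
  shows "d ((T ^^ n) x0) ((T ^^ Suc n) x0) \<le> \<alpha> ^ n * d x0 (T x0)"
proof (induction n)
  case (Suc n)
  define x where "x = (T ^^ n) x0"
  have x: "x \<in> X" "T x \<in> X"
    using orbit_in[OF x0, of n] maps by (auto simp: x_def)
  have "d (T x) (T (T x)) \<le> \<alpha> * d x (T x)"
    using contraction[OF x] dist_eq_0_iff[OF x(2) x(2)] by simp
  also have "\<dots> \<le> \<alpha> * (\<alpha> ^ n * d x0 (T x0))"
    using Suc.IH alpha_nonneg by (intro mult_left_mono) (simp_all add: x_def)
  finally show ?case
    by (simp add: x_def mult.assoc)
qed simp

text \<open>The first jump from \<open>x\<^sub>n\<close> costs at most \<open>c = \<alpha> ^ n * d x\<^sub>0 x\<^sub>1\<close>, the rest inductively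
  \<open>\<alpha> * k * c\<close>; together \<open>\<Phi> c (\<alpha> * k * c) = c * \<Phi> 1 (\<alpha> * k) \<le> c * k\<close>.\<close>

lemma orbit_spread:
  assumes x0: "x0 \<in> X" and k: "admissible_ratio \<Phi> \<alpha> k"
  shows "d ((T ^^ n) x0) ((T ^^ (n + j)) x0) \<le> \<alpha> ^ n * k * d x0 (T x0)"
proof (induction j arbitrary: n)
  case 0
  have "0 \<le> \<alpha> ^ n * k * d x0 (T x0)"
    using k alpha_nonneg dist_nonneg[OF x0] orbit_in[OF x0, of 1]
    by (simp add: admissible_ratio_def)
  then show ?case
    using dist_eq_0_iff[OF orbit_in[OF x0] orbit_in[OF x0], of n n] by simp
next
  case (Suc j)
  define c where "c = \<alpha> ^ n * d x0 (T x0)"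
  have c: "c \<ge> 0"
    using alpha_nonneg dist_nonneg[OF x0] orbit_in[OF x0, of 1] by (simp add: c_def)
  have "d ((T ^^ n) x0) ((T ^^ (n + Suc j)) x0) \<le> \<Phi> (c * 1) (c * (\<alpha> * k))"
  proof (rule dist_le_gauge[of _ _ "(T ^^ Suc n) x0"])
    show "d ((T ^^ n) x0) ((T ^^ Suc n) x0) \<le> c * 1"
      using orbit_step[OF x0, of n] by (simp add: c_def)
    show "d ((T ^^ Suc n) x0) ((T ^^ (n + Suc j)) x0) \<le> c * (\<alpha> * k)"
      using Suc.IH[of "Suc n"] by (simp add: c_def mult_ac)
  qed (use orbit_in[OF x0] in \<open>auto simp del: funpow.simps\<close>)
  also have "\<dots> = c * \<Phi> 1 (\<alpha> * k)"
    using c k alpha_nonneg by (intro gauge_scale) (auto simp: admissible_ratio_def)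
  also have "\<dots> \<le> c * k"
    using c k by (auto simp: admissible_ratio_def intro: mult_left_mono)
  finally show ?case
    by (simp add: c_def mult_ac)
qed

lemma orbit_Cauchy:
  assumes x0: "x0 \<in> X" and k: "admissible_ratio \<Phi> \<alpha> k"
  shows "semimetric_Cauchy d (\<lambda>n. (T ^^ n) x0)"
  unfolding semimetric_Cauchy_def
proof (rule tendstoI)
  fix e :: real
  assume "e > 0"
  define x where "x = (\<lambda>n. (T ^^ n) x0)"
  define K where "K = k * d x0 (T x0)"
  have x: "x n \<in> X" for n
    using orbit_in[OF x0] by (simp add: x_def)
  have K: "K \<ge> 0"
    using k dist_nonneg[OF x0] x[of 1] by (simp add: x_def K_def admissible_ratio_def)
  have "(\<lambda>n. \<alpha> ^ n * K) \<longlonglongrightarrow> 0"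
    using alpha_nonneg alpha_less_1 by (auto intro!: tendsto_mult_left_zero LIMSEQ_realpow_zero)
  then have "\<forall>\<^sub>F n in sequentially. \<alpha> ^ n * K < e"
    using \<open>e > 0\<close> by (rule order_tendstoD(2))
  then obtain N where N: "\<And>n. n \<ge> N \<Longrightarrow> \<alpha> ^ n * K < e"
    by (auto simp: eventually_sequentially)
  have ordered: "d (x n) (x m) < e" if "n \<ge> N" "n \<le> m" for n m
    using orbit_spread[OF x0 k, of n "m - n"] N[OF that(1)] that(2)
    by (simp add: x_def K_def mult.assoc)
  have "d (x n) (x m) < e" if "n \<ge> N" "m \<ge> N" for n m
    using ordered[of n m] ordered[of m n] that dist_sym[OF x x, of n m] by (cases "n \<le> m") auto
  then have "\<bar>d (x n) (x m)\<bar> < e" if "n \<ge> N" "m \<ge> N" for n m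
    using that dist_nonneg[OF x x, of n m] by simp
  then show "\<forall>\<^sub>F p in sequentially \<times>\<^sub>F sequentially.
               dist (case p of (n, m) \<Rightarrow> d ((T ^^ n) x0) ((T ^^ m) x0)) 0 < e"
    by (auto simp: eventually_prod_sequentially x_def)
qed

lemma orbit_limit_bound:
  assumes x0: "x0 \<in> X" and x: "x \<in> X" and k: "admissible_ratio \<Phi> \<alpha> k"
    and lim: "semimetric_converges d (\<lambda>n. (T ^^ n) x0) x"
  shows "d ((T ^^ n) x0) x \<le> \<alpha> ^ n * k * d x0 (T x0)"
proof (rule dist_le_of_limit[OF orbit_in[OF x0] x orbit_in[OF x0] lim])
  have "d ((T ^^ n) x0) ((T ^^ m) x0) \<le> \<alpha> ^ n * k * d x0 (T x0)" if "m \<ge> n" for m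
    using orbit_spread[OF x0 k, of n "m - n"] that by simp
  then show "\<forall>\<^sub>F m in sequentially. d ((T ^^ n) x0) ((T ^^ m) x0) \<le> \<alpha> ^ n * k * d x0 (T x0)"
    by (auto simp: eventually_sequentially)
qed

text \<open>The contraction condition for \<open>x\<^sub>n\<close> and the limit \<open>x\<close> bounds \<open>d x\<^sub>n\<^sub>+\<^sub>1 (T x)\<close> by
  \<open>\<alpha> * d x\<^sub>n x + \<delta> * d x x\<^sub>n\<^sub>+\<^sub>1\<close>.  So the shifted orbit converges to \<open>T x\<close> as well as to \<open>x\<close>.\<close>

lemma orbit_limit_fixed:
  assumes x0: "x0 \<in> X" and x: "x \<in> X"
    and lim: "semimetric_converges d (\<lambda>n. (T ^^ n) x0) x"
  shows "T x = x"
proof -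
  define s where "s = (\<lambda>n. (T ^^ n) x0)"
  have s: "s n \<in> X" for n
    using orbit_in[OF x0] by (simp add: s_def)
  have Tx: "T x \<in> X"
    using maps x by auto
  have lim0: "(\<lambda>n. d (s n) x) \<longlonglongrightarrow> 0"
    using lim by (simp add: semimetric_converges_def s_def)
  then have lim1: "(\<lambda>n. d (s (Suc n)) x) \<longlonglongrightarrow> 0"
    by (rule LIMSEQ_Suc)
  have "(\<lambda>n. \<alpha> * d (s n) x + \<delta> * d (s (Suc n)) x) \<longlonglongrightarrow> \<alpha> * 0 + \<delta> * 0"
    by (intro tendsto_intros lim0 lim1)
  then have upper: "(\<lambda>n. \<alpha> * d (s n) x + \<delta> * d (s (Suc n)) x) \<longlonglongrightarrow> 0"
    by simp
  have "d (s (Suc n)) (T x) \<le> \<alpha> * d (s n) x + \<delta> * d (s (Suc n)) x" for n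
    using contraction[OF s x, of n] dist_sym[OF x s, of "Suc n"] by (simp add: s_def)
  then have "(\<lambda>n. d (s (Suc n)) (T x)) \<longlonglongrightarrow> 0"
    using dist_nonneg[OF s Tx]
    by (intro tendsto_sandwich[OF _ _ tendsto_const upper] always_eventually) auto
  then show ?thesis
    using limit_unique[of "\<lambda>n. s (Suc n)" "T x" x] s Tx x lim1
    by (simp add: semimetric_converges_def)
qed

lemma fixed_point_unique:
  assumes "\<delta> = 0" and x: "x \<in> X" "T x = x" and y: "y \<in> X" "T y = y"
  shows "x = y"
proof (rule ccontr)
  assume "x \<noteq> y"
  then have "d x y > 0"
    using dist_nonneg[OF x(1) y(1)] dist_eq_0_iff[OF x(1) y(1)] by linarith
  then have "\<alpha> * d x y < d x y"
    using alpha_less_1 by simp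
  then show False
    using contraction[OF x(1) y(1)] assms by simp
qed

end

section \<open>The fixed point theorem\<close>

theorem corollary2p3:
  fixes X :: "'a set" and d :: "'a \<Rightarrow> 'a \<Rightarrow> real" and \<Phi> :: "real \<Rightarrow> real \<Rightarrow> real"
    and T :: "'a \<Rightarrow> 'a" and \<alpha> \<delta> :: real
  assumes "semimetric_space X d"
    and "semimetric_complete X d"
    and "triangle_function X d \<Phi>"
    and "eq_on_nonneg \<Phi> (\<lambda>u v. u + v)
         \<or> eq_on_nonneg \<Phi> (\<lambda>u v. max u v)
         \<or> (\<exists>q>0. eq_on_nonneg \<Phi> (\<lambda>u v. (u powr q + v powr q) powr (1 / q)))"
    and "T \<in> X \<rightarrow> X"
    and "0 \<le> \<alpha>" and "\<alpha> < 1" and "0 \<le> \<delta>"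
    and "\<And>x y. x \<in> X \<Longrightarrow> y \<in> X \<Longrightarrow> d (T x) (T y) \<le> \<alpha> * d x y + \<delta> * d y (T x)"
  shows "(\<exists>x\<in>X. T x = x)
    \<and> (\<delta> = 0 \<longrightarrow> (\<exists>!x. x \<in> X \<and> T x = x))
    \<and> (\<forall>x0\<in>X. \<exists>xs\<in>X. T xs = xs \<and> (\<forall>n::nat.
         (eq_on_nonneg \<Phi> (\<lambda>u v. u + v) \<longrightarrow>
            d ((T ^^ n) x0) xs \<le> \<alpha> ^ n / (1 - \<alpha>) * d x0 (T x0))
       \<and> (eq_on_nonneg \<Phi> (\<lambda>u v. max u v) \<longrightarrow>
            d ((T ^^ n) x0) xs \<le> \<alpha> ^ n * d x0 (T x0))
       \<and> (\<forall>q>0. eq_on_nonneg \<Phi> (\<lambda>u v. (u powr q + v powr q) powr (1 / q)) \<longrightarrow>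
            d ((T ^^ n) x0) xs \<le> \<alpha> ^ n / (1 - \<alpha> powr q) powr (1 / q) * d x0 (T x0))))"
proof -
  have "\<exists>\<Psi> k. eq_on_nonneg \<Phi> \<Psi> \<and> homogeneous_gauge \<Psi> \<and> admissible_ratio \<Psi> \<alpha> k"
    using assms(4) homogeneous_gauge_sum homogeneous_gauge_max homogeneous_gauge_power
      admissible_ratio_sum[OF assms(7)] admissible_ratio_max[OF assms(7)]
      admissible_ratio_power[OF _ assms(6,7)]
    by meson
  then obtain k where gauge: "homogeneous_gauge \<Phi>" and k: "admissible_ratio \<Phi> \<alpha> k"
    using homogeneous_gauge_cong admissible_ratio_cong assms(6) by meson
  interpret almost_contraction X d \<Phi> T \<alpha> \<delta>
    by unfold_locales (use assms gauge in auto)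

  have orbit: "\<exists>xs\<in>X. T xs = xs \<and>
      (\<forall>k n. admissible_ratio \<Phi> \<alpha> k \<longrightarrow> d ((T ^^ n) x0) xs \<le> \<alpha> ^ n * k * d x0 (T x0))"
    if x0: "x0 \<in> X" for x0
  proof -
    obtain xs where "xs \<in> X" "semimetric_converges d (\<lambda>n. (T ^^ n) x0) xs"
      using assms(2)[unfolded semimetric_complete_def, rule_format, of "\<lambda>n. (T ^^ n) x0"]
        orbit_Cauchy[OF x0 k] orbit_in[OF x0] by blast
    then show ?thesis
      using orbit_limit_fixed[OF x0] orbit_limit_bound[OF x0] by blast
  qed
  have existence: "\<exists>x\<in>X. T x = x"
    using orbit assms(1) by (auto simp: semimetric_space_def)
  moreover have "\<delta> = 0 \<longrightarrow> (\<exists>!x. x \<in> X \<and> T x = x)"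
    using existence fixed_point_unique by blast
  moreover have "\<exists>xs\<in>X. T xs = xs \<and> (\<forall>n::nat.
         (eq_on_nonneg \<Phi> (\<lambda>u v. u + v) \<longrightarrow>
            d ((T ^^ n) x0) xs \<le> \<alpha> ^ n / (1 - \<alpha>) * d x0 (T x0))
       \<and> (eq_on_nonneg \<Phi> (\<lambda>u v. max u v) \<longrightarrow>
            d ((T ^^ n) x0) xs \<le> \<alpha> ^ n * d x0 (T x0))
       \<and> (\<forall>q>0. eq_on_nonneg \<Phi> (\<lambda>u v. (u powr q + v powr q) powr (1 / q)) \<longrightarrow>
            d ((T ^^ n) x0) xs \<le> \<alpha> ^ n / (1 - \<alpha> powr q) powr (1 / q) * d x0 (T x0)))"
    if x0: "x0 \<in> X" for x0
  proof -
    obtain xs where xs: "xs \<in> X" "T xs = xs"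
      and bound: "\<And>k n. admissible_ratio \<Phi> \<alpha> k \<Longrightarrow> d ((T ^^ n) x0) xs \<le> \<alpha> ^ n * k * d x0 (T x0)"
      using orbit[OF x0] by blast
    have "d ((T ^^ n) x0) xs \<le> \<alpha> ^ n / (1 - \<alpha>) * d x0 (T x0)"
      if "eq_on_nonneg \<Phi> (\<lambda>u v. u + v)" for n
      using bound[OF admissible_ratio_cong[OF that admissible_ratio_sum[OF assms(7)] assms(6)]]
      by simp
    moreover have "d ((T ^^ n) x0) xs \<le> \<alpha> ^ n * d x0 (T x0)"
      if "eq_on_nonneg \<Phi> (\<lambda>u v. max u v)" for n
      using bound[OF admissible_ratio_cong[OF that admissible_ratio_max[OF assms(7)] assms(6)]]
      by simp
    moreover have "d ((T ^^ n) x0) xs \<le> \<alpha> ^ n / (1 - \<alpha> powr q) powr (1 / q) * d x0 (T x0)"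
      if "q > 0" "eq_on_nonneg \<Phi> (\<lambda>u v. (u powr q + v powr q) powr (1 / q))" for n q
      using bound[OF admissible_ratio_cong[OF that(2)
            admissible_ratio_power[OF that(1) assms(6,7)] assms(6)]]
      by simp
    ultimately show ?thesis
      using xs by blast
  qed
  ultimately show ?thesis
    by blast
qed

end
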